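(* For every integer $n\ge 1$, $$\sigma(n)=\min_S\max_\mu B_S(\mu)\ \ge\ \left\lceil \frac{n(n-2)}{6}\right\rceil ,$$ where the minimum is over all strict complete preference profiles $S$ of size $n$ and the maximum is over all complete matchings $\mu$.
   Context: An instance (profile) $S$ of size $n$ of the stable marriage problem consists of $n$ men $m_0,\dots,m_{n-1}$ and $n$ women $w_0,\dots,w_{n-1}$, where each man has a strict complete preference order on the women and each woman has a strict complete preference order on the men. A complete matching $\mu$ is a bijection from men to women. A pair $(m_i,w_j)$ is a blocking pair of $\mu$ if $m_i$ strictly prefers $w_j$ to $\mu(m_i)$ and $w_j$ strictly prefers $m_i$ to $\mu^{-1}(w_j)$. $B_S(\mu)$ denotes the number of blocking pairs of $\mu$ in $S$. The number $\sigma(n)=\min_S\max_\mu B_S(\mu)$ is called the Shield number. *)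

theory Defs
  imports Complex_Main
begin

(* Men and women are both indexed by {..<n}.  (j, j') : man_pref S i means that man i
   strictly prefers woman j to woman j'; women's preferences are read likewise.
   Values of the two fields at indices outside {..<n} are irrelevant. *)
record profile =
  man_pref :: "nat \<Rightarrow> nat rel"
  woman_pref :: "nat \<Rightarrow> nat rel"

definition strict_preference :: "nat \<Rightarrow> nat rel \<Rightarrow> bool" where
  "strict_preference n r \<longleftrightarrow> r \<subseteq> {..<n} \<times> {..<n} \<and> strict_linear_order_on {..<n} r"

definition is_profile :: "nat \<Rightarrow> profile \<Rightarrow> bool" where
  "is_profile n S \<longleftrightarrow>
     (\<forall>i<n. strict_preference n (man_pref S i)) \<and> (\<forall>j<n. strict_preference n (woman_pref S j))"

definition complete_matching :: "nat \<Rightarrow> (nat \<Rightarrow> nat) \<Rightarrow> bool" where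
  "complete_matching n \<mu> \<longleftrightarrow> bij_betw \<mu> {..<n} {..<n}"

definition blocking_pairs :: "nat \<Rightarrow> profile \<Rightarrow> (nat \<Rightarrow> nat) \<Rightarrow> (nat \<times> nat) set" where
  "blocking_pairs n S \<mu> =
     {(i, j). i < n \<and> j < n \<and>
        (j, \<mu> i) \<in> man_pref S i \<and> (i, inv_into {..<n} \<mu> j) \<in> woman_pref S j}"

definition num_blocking :: "nat \<Rightarrow> profile \<Rightarrow> (nat \<Rightarrow> nat) \<Rightarrow> nat" where
  "num_blocking n S \<mu> = card (blocking_pairs n S \<mu>)"

definition max_blocking :: "nat \<Rightarrow> profile \<Rightarrow> nat" where
  "max_blocking n S = Max {num_blocking n S \<mu> | \<mu>. complete_matching n \<mu>}"

definition shield_number :: "nat \<Rightarrow> nat" where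
  "shield_number n = Min {max_blocking n S | S. is_profile n S}"

(* Max and Min are only meaningful on finite nonempty sets; the facts below show that
   both uses above are of this kind. *)

lemma num_blocking_le: "num_blocking n S \<mu> \<le> n * n"
proof -
  have "card (blocking_pairs n S \<mu>) \<le> card ({..<n} \<times> {..<n})"
    by (rule card_mono) (auto simp: blocking_pairs_def)
  then show ?thesis
    by (simp add: num_blocking_def)
qed

lemma finite_num_blocking: "finite {num_blocking n S \<mu> | \<mu>. complete_matching n \<mu>}"
  by (rule finite_subset[of _ "{..n * n}"]) (auto simp: num_blocking_le)

lemma complete_matching_id: "complete_matching n id"
  by (simp add: complete_matching_def)

lemma nonempty_num_blocking: "{num_blocking n S \<mu> | \<mu>. complete_matching n \<mu>} \<noteq> {}"
  using complete_matching_id by blast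

lemma max_blocking_le: "max_blocking n S \<le> n * n"
  unfolding max_blocking_def
  using finite_num_blocking nonempty_num_blocking by (subst Max_le_iff) (auto simp: num_blocking_le)

lemma finite_max_blocking: "finite {max_blocking n S | S. is_profile n S}"
  by (rule finite_subset[of _ "{..n * n}"]) (auto simp: max_blocking_le)

lemma is_profile_exists: "\<exists>S. is_profile n S"
proof
  let ?r = "{(a, b). a < b \<and> b < n}"
  have "strict_preference n ?r"
    unfolding strict_preference_def strict_linear_order_on_def
    by (auto simp: trans_def irrefl_def total_on_def)
  then show "is_profile n \<lparr>man_pref = \<lambda>_. ?r, woman_pref = \<lambda>_. ?r\<rparr>"
    by (simp add: is_profile_def)
qed

lemma nonempty_max_blocking: "{max_blocking n S | S. is_profile n S} \<noteq> {}"
  using is_profile_exists by blast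

end

(* Average the number of blocking pairs over all matchings. Let x i j be the number of women
   that man i likes less than woman j, and y i j the number of men that woman j likes less than
   man i. For distinct men i, l and distinct women j, k a uniformly random matching pairs i with k
   and l with j with probability 1 / (n (n - 1)), so the expected number of blocking pairs is
   (sum of x i j * y i j) / (n (n - 1)). Each row of x and each column of y is a permutation of
   0, ..., n - 1, so expanding sum of (x i j + y i j - (n - 1))^2 >= 0 bounds the sum of the
   products from below by n^2 (n - 1) (n - 2) / 6. *)
theory Submission
  imports Defs "HOL-Combinatorics.Permutations"
begin

text \<open>Two transpositions suffice: the first sends \<open>a\<close> to \<open>a'\<close>, the
  second sends the image of \<open>b\<close> to \<open>b'\<close>. The second fixes
  \<open>a'\<close>, since neither that image nor \<open>b'\<close> equals
  \<open>a'\<close>.\<close>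

lemma permutes_two_points:
  assumes "a \<in> A" "b \<in> A" "a' \<in> A" "b' \<in> A" "a \<noteq> b" "a' \<noteq> b'"
  obtains q where "q permutes A" "q a = a'" "q b = b'"
proof
  let ?t = "transpose a a'"
  let ?q = "transpose (?t b) b' \<circ> ?t"
  have t: "?t permutes A"
    using assms by (intro permutes_swap_id)
  then have "?t b \<in> A"
    using assms(2) by (simp add: permutes_in_image)
  then show "?q permutes A"
    using assms t by (intro permutes_compose permutes_swap_id)
  show "?q a = a'" "?q b = b'"
    using assms by (auto simp: transpose_def)
qed

text \<open>The permutations split into fibres of \<open>p\<close> \<mapsto>
  \<open>(p i, p l)\<close>, one for each ordered pair of distinct values. Composing on the left
  with a permutation that carries one pair to another shows that all fibres have equal size. Keeping
  the number of fibres as a factor avoids division.\<close>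

lemma card_permutes_two_points:
  assumes "finite A" "i \<in> A" "l \<in> A" "k \<in> A" "j \<in> A" "i \<noteq> l" "k \<noteq> j"
  shows "card A * (card A - 1) * card {p. p permutes A \<and> p i = k \<and> p l = j} = fact (card A)"
proof -
  define N where "N = (\<lambda>(k, j). {p. p permutes A \<and> p i = k \<and> p l = j})"
  define D where "D = (SIGMA k:A. A - {k})"
  have finN: "finite (N d)" for d
    using finite_permutations[OF assms(1)]
    by (rule finite_subset[rotated]) (auto simp: N_def split: prod.splits)
  have le: "card (N d) \<le> card (N e)" if "d \<in> D" "e \<in> D" for d e
  proof -
    obtain k j k' j' where de: "d = (k, j)" "e = (k', j')"
      by (cases d, cases e)
    have "k \<in> A" "j \<in> A" "k' \<in> A" "j' \<in> A" "k \<noteq> j" "k' \<noteq> j'"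
      using that by (auto simp: de D_def)
    then obtain q where q: "q permutes A" "q k = k'" "q j = j'"
      by (rule permutes_two_points)
    have "inj_on ((\<circ>) q) (N d)"
      using permutes_inj[OF q(1)] by (auto simp: inj_on_def fun_eq_iff dest: injD)
    moreover have "(\<circ>) q ` N d \<subseteq> N e"
      using q by (auto simp: N_def de intro: permutes_compose)
    ultimately show ?thesis
      using finN by (rule card_inj_on_le)
  qed
  have kj: "(k, j) \<in> D"
    using assms by (auto simp: D_def)
  have "{p. p permutes A} = (\<Union>d\<in>D. N d)"
  proof (intro equalityI subsetI)
    fix p assume "p \<in> {p. p permutes A}"
    then have p: "p permutes A" by simp
    then have "(p i, p l) \<in> D"
      using assms permutes_inj[OF p] by (auto simp: D_def permutes_in_image dest: injD)
    with p show "p \<in> (\<Union>d\<in>D. N d)"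
      by (auto simp: N_def)
  qed (auto simp: N_def)
  moreover have finD: "finite D"
    using assms(1) by (auto simp: D_def)
  moreover have "card (\<Union>d\<in>D. N d) = (\<Sum>d\<in>D. card (N d))"
    using finD finN by (intro card_UN_disjoint) (auto simp: N_def)
  ultimately have "fact (card A) = (\<Sum>d\<in>D. card (N d))"
    using card_permutations[OF refl assms(1)] by simp
  \<comment> \<open>\<open>le\<close> holds for any two pairs in \<open>D\<close>, so using it in
    both directions gives equality.\<close>
  also have "\<dots> = (\<Sum>d\<in>D. card (N (k, j)))"
    using le kj by (intro sum.cong refl antisym)
  also have "\<dots> = card D * card (N (k, j))"
    by simp
  also have "card D = card A * (card A - 1)"
    using assms(1) by (simp add: D_def card_SigmaI)
  finally show ?thesis
    by (simp add: N_def)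
qed

text \<open>If \<open>a\<close> is preferred to \<open>b\<close>, everything below \<open>b\<close>
  is below \<open>a\<close>, and \<open>b\<close> is below \<open>a\<close> but not below itself. So
  the rank is strictly monotone, hence injective by totality, and an injective self-map of a finite
  set is onto.\<close>

lemma bij_betw_card_less_preferred:
  assumes "strict_preference n r"
  shows "bij_betw (\<lambda>a. card {b. (a, b) \<in> r}) {..<n} {..<n}"
proof -
  let ?W = "\<lambda>a. {b. (a, b) \<in> r}"
  have r: "r \<subseteq> {..<n} \<times> {..<n}" "trans r" "irrefl r" "total_on {..<n} r"
    using assms by (auto simp: strict_preference_def strict_linear_order_on_def)
  have fin: "finite (?W a)" for a
    by (rule finite_subset[of _ "{..<n}"]) (use r(1) in auto)
  have lt: "card (?W b) < card (?W a)" if "(a, b) \<in> r" for a b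
    using that r(2,3) fin
    by (intro psubset_card_mono) (auto simp: irrefl_def dest: transD)
  have inj: "inj_on (\<lambda>a. card (?W a)) {..<n}"
    using r(4) lt by (intro inj_onI) (metis less_irrefl total_on_def)
  have "card (?W a) < n" if "a < n" for a
  proof -
    have "?W a \<subset> {..<n}"
      using r(1,3) that by (auto simp: irrefl_def)
    from psubset_card_mono[OF _ this] show ?thesis by simp
  qed
  then have "(\<lambda>a. card (?W a)) ` {..<n} = {..<n}"
    using inj by (intro endo_inj_surj) auto
  with inj show ?thesis
    by (simp add: bij_betw_def)
qed

lemma sum_of_nat_lessThan: "(\<Sum>k<n. real k) = real n * (real n - 1) / 2"
  by (induction n) (auto simp: field_simps)

lemma sum_of_nat_squares_lessThan:
  "(\<Sum>k<n. (real k)\<^sup>2) = real n * (real n - 1) * (2 * real n - 1) / 6"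
  by (induction n) (auto simp: field_simps power2_eq_square)

lemma sum_products_of_ranks_ge:
  fixes x y :: "nat \<Rightarrow> nat \<Rightarrow> nat"
  assumes x: "\<And>i. i < n \<Longrightarrow> bij_betw (x i) {..<n} {..<n}"
    and y: "\<And>j. j < n \<Longrightarrow> bij_betw (\<lambda>i. y i j) {..<n} {..<n}"
  shows "real n * real n * (real n - 1) * (real n - 2) / 6
    \<le> (\<Sum>i<n. \<Sum>j<n. real (x i j) * real (y i j))"
proof -
  \<comment> \<open>Both ranks average (n - 1) / 2 over the grid, so \<open>?c\<close> is the mean
    of their sum, the centre that makes the resulting bound strongest.\<close>
  let ?c = "real n - 1"
  have X: "(\<Sum>i<n. \<Sum>j<n. f (x i j)) = real n * (\<Sum>k<n. f k)" for f :: "nat \<Rightarrow> real"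
    using sum.reindex_bij_betw[OF x, of _ f] by simp
  have "(\<Sum>i<n. \<Sum>j<n. f (y i j)) = (\<Sum>j<n. \<Sum>i<n. f (y i j))" for f :: "nat \<Rightarrow> real"
    by (rule sum.swap)
  then have Y: "(\<Sum>i<n. \<Sum>j<n. f (y i j)) = real n * (\<Sum>k<n. f k)" for f :: "nat \<Rightarrow> real"
    using sum.reindex_bij_betw[OF y, of _ f] by simp
  have "0 \<le> (\<Sum>i<n. \<Sum>j<n. (real (x i j) + real (y i j) - ?c)\<^sup>2)"
    by (intro sum_nonneg) simp
  \<comment> \<open>Apart from the product, each bracket depends on one rank only and has the same
    shape, so \<open>X\<close> and \<open>Y\<close> evaluate both.\<close>
  also have "\<dots> = (\<Sum>i<n. \<Sum>j<n. 2 * (real (x i j) * real (y i j))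
      + ((real (x i j))\<^sup>2 - 2 * ?c * real (x i j)) + ((real (y i j))\<^sup>2 - 2 * ?c * real (y i j)) + ?c\<^sup>2)"
    by (intro sum.cong refl) (simp add: power2_eq_square algebra_simps)
  also have "\<dots> = 2 * (\<Sum>i<n. \<Sum>j<n. real (x i j) * real (y i j))
      + 2 * (real n * (\<Sum>k<n. (real k)\<^sup>2 - 2 * ?c * real k)) + real n * (real n * ?c\<^sup>2)"
    using X[of "\<lambda>k. (real k)\<^sup>2 - 2 * ?c * real k"] Y[of "\<lambda>k. (real k)\<^sup>2 - 2 * ?c * real k"]
    by (simp only: sum.distrib sum_distrib_left[symmetric] sum_constant card_lessThan)
  also have "(\<Sum>k<n. (real k)\<^sup>2 - 2 * ?c * real k)
      = real n * (real n - 1) * (2 * real n - 1) / 6 - 2 * ?c * (real n * (real n - 1) / 2)"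
    by (simp only: sum_subtractf sum_distrib_left[symmetric] sum_of_nat_lessThan
        sum_of_nat_squares_lessThan)
  finally show ?thesis
    by (simp add: field_simps power2_eq_square)
qed

text \<open>Double counting of matchings with a blocking pair \<open>(i, j)\<close>, split by the
  partners of \<open>i\<close> and \<open>j\<close>. Summing over permutations, which are the
  identity outside \<open>{..<n}\<close>, gives a finite family of n! matchings.\<close>

lemma sum_num_blocking:
  assumes S: "is_profile n S"
  shows "n * (n - 1) * (\<Sum>p | p permutes {..<n}. num_blocking n S p) =
    fact n * (\<Sum>i<n. \<Sum>j<n. card {k. (j, k) \<in> man_pref S i} * card {l. (i, l) \<in> woman_pref S j})"
proof -
  let ?P = "{p. p permutes {..<n}}"
  let ?M = "\<lambda>i j. {k. (j, k) \<in> man_pref S i}"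
  let ?W = "\<lambda>i j. {l. (i, l) \<in> woman_pref S j}"
  let ?N = "\<lambda>i l k j. {p. p permutes {..<n} \<and> p i = k \<and> p l = j}"
  let ?B = "\<lambda>i j. {p. p permutes {..<n} \<and> (i, j) \<in> blocking_pairs n S p}"
  have finP: "finite ?P"
    by (simp add: finite_permutations)
  have finN: "finite (?N i l k j)" for i l k j
    using finP by (rule finite_subset[rotated]) auto
  \<comment> \<open>Excluding \<open>j\<close> and \<open>i\<close> supplies the distinctness needed
    to count permutations with two prescribed values.\<close>
  have sub: "?M i j \<subseteq> {..<n} - {j}" "?W i j \<subseteq> {..<n} - {i}" if "i < n" "j < n" for i j
    using S that
    by (auto simp: is_profile_def strict_preference_def strict_linear_order_on_def irrefl_def)
  have cell: "n * (n - 1) * card (?B i j) = fact n * (card (?M i j) * card (?W i j))"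
    if ij: "i < n" "j < n" for i j
  proof -
    have finMW: "finite (?M i j \<times> ?W i j)"
      using sub[OF ij] by (auto intro: finite_subset)
    have B: "?B i j = (\<Union>(k, l)\<in>?M i j \<times> ?W i j. ?N i l k j)"
    proof (intro set_eqI)
      fix p
      have inv: "inv_into {..<n} p j = l \<longleftrightarrow> p l = j" if "p permutes {..<n}" "l < n" for l
        using that ij permutes_image[OF that(1)] permutes_inj_on[OF that(1), of "{..<n}"]
        by (metis f_inv_into_f inv_into_f_f lessThan_iff)
      have inv_less: "inv_into {..<n} p j < n" if "p permutes {..<n}"
        using inv_into_into[of j p "{..<n}"] permutes_image[OF that] ij by simp
      have "(i, inv_into {..<n} p j) \<in> woman_pref S j \<longleftrightarrow> (\<exists>l. (i, l) \<in> woman_pref S j \<and> p l = j)"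
        if p: "p permutes {..<n}"
      proof -
        have "l < n" if "(i, l) \<in> woman_pref S j" for l
          using that sub(2)[OF ij] by auto
        then show ?thesis
          using inv[OF p] inv_less[OF p] by metis
      qed
      then show "p \<in> ?B i j \<longleftrightarrow> p \<in> (\<Union>(k, l)\<in>?M i j \<times> ?W i j. ?N i l k j)"
        using ij by (auto simp: blocking_pairs_def)
    qed
    have "card (?B i j) = (\<Sum>(k, l)\<in>?M i j \<times> ?W i j. card (?N i l k j))"
      unfolding B
    proof (subst card_UN_disjoint)
      \<comment> \<open>\<open>p\<close> determines \<open>k\<close> as \<open>p i\<close>, and
        determines \<open>l\<close> by injectivity from \<open>p l = j\<close>.\<close>
      show "\<forall>d\<in>?M i j \<times> ?W i j. \<forall>e\<in>?M i j \<times> ?W i j. d \<noteq> e \<longrightarrow>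
          (case d of (k, l) \<Rightarrow> ?N i l k j) \<inter> (case e of (k, l) \<Rightarrow> ?N i l k j) = {}"
        by (auto dest: permutes_inj injD)
    qed (use finMW finN in \<open>auto intro!: sum.cong\<close>)
    then have "n * (n - 1) * card (?B i j)
        = (\<Sum>(k, l)\<in>?M i j \<times> ?W i j. n * (n - 1) * card (?N i l k j))"
      by (simp only: sum_distrib_left case_prod_unfold)
    also have "\<dots> = (\<Sum>(k, l)\<in>?M i j \<times> ?W i j. fact n)"
    proof (intro sum.cong refl, clarify)
      fix k l assume "(j, k) \<in> man_pref S i" "(i, l) \<in> woman_pref S j"
      then show "n * (n - 1) * card (?N i l k j) = fact n"
        using sub[OF ij] ij card_permutes_two_points[of "{..<n}" i l k j] by auto
    qed
    also have "\<dots> = fact n * (card (?M i j) * card (?W i j))"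
      by (simp add: card_cartesian_product)
    finally show ?thesis .
  qed
  have "(\<Sum>p\<in>?P. num_blocking n S p)
      = (\<Sum>p\<in>?P. card {d \<in> {..<n} \<times> {..<n}. d \<in> blocking_pairs n S p})"
    unfolding num_blocking_def
    by (intro sum.cong refl arg_cong[where f = card]) (auto simp: blocking_pairs_def)
  also have "\<dots> = (\<Sum>d\<in>{..<n} \<times> {..<n}. card {p \<in> ?P. d \<in> blocking_pairs n S p})"
    using finP by (intro sum_multicount_gen) auto
  also have "\<dots> = (\<Sum>i<n. \<Sum>j<n. card (?B i j))"
    by (simp add: sum.cartesian_product case_prod_unfold)
  finally show ?thesis
    by (simp only: sum_distrib_left) (intro sum.cong refl cell, auto)
qed

text \<open>The maximum is at least the average over permutations. The case n = 1 is separate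
  because the factor n (n - 1) to be cancelled vanishes there; the bound is then negative.\<close>

lemma max_blocking_ge:
  assumes "n \<ge> 1" and S: "is_profile n S"
  shows "real n * (real n - 2) / 6 \<le> real (max_blocking n S)"
proof (cases "n = 1")
  case False
  with assms have n: "n \<ge> 2" by simp
  let ?P = "{p. p permutes {..<n}}"
  let ?x = "\<lambda>i j. card {k. (j, k) \<in> man_pref S i}"
  let ?y = "\<lambda>i j. card {l. (i, l) \<in> woman_pref S j}"
  have "num_blocking n S p \<le> max_blocking n S" if "p \<in> ?P" for p
    unfolding max_blocking_def using that finite_num_blocking
    by (intro Max_ge) (auto simp: complete_matching_def permutes_imp_bij)
  then have "(\<Sum>p\<in>?P. num_blocking n S p) \<le> of_nat (card ?P) * max_blocking n S"
    by (rule sum_bounded_above)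
  then have "n * (n - 1) * (\<Sum>p\<in>?P. num_blocking n S p)
      \<le> n * (n - 1) * (fact n * max_blocking n S)"
    by (intro mult_left_mono) (simp_all add: card_permutations)
  then have "fact n * (\<Sum>i<n. \<Sum>j<n. ?x i j * ?y i j) \<le> fact n * (n * (n - 1) * max_blocking n S)"
    unfolding sum_num_blocking[OF S] by (simp only: mult_ac)
  then have "(\<Sum>i<n. \<Sum>j<n. ?x i j * ?y i j) \<le> n * (n - 1) * max_blocking n S"
    by simp
  then have "real (\<Sum>i<n. \<Sum>j<n. ?x i j * ?y i j) \<le> real (n * (n - 1) * max_blocking n S)"
    by (simp only: of_nat_le_iff)
  moreover have "real (n * (n - 1) * max_blocking n S) = (real n * (real n - 1)) * real (max_blocking n S)"
    using n by (simp add: of_nat_diff)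
  ultimately have "(\<Sum>i<n. \<Sum>j<n. real (?x i j) * real (?y i j))
      \<le> (real n * (real n - 1)) * real (max_blocking n S)"
    by (simp only: of_nat_sum of_nat_mult)
  moreover have "(real n * (real n - 1)) * (real n * (real n - 2) / 6)
      = real n * real n * (real n - 1) * (real n - 2) / 6"
    by simp
  moreover have "real n * real n * (real n - 1) * (real n - 2) / 6
      \<le> (\<Sum>i<n. \<Sum>j<n. real (?x i j) * real (?y i j))"
    using S by (intro sum_products_of_ranks_ge bij_betw_card_less_preferred)
      (auto simp: is_profile_def)
  ultimately have "(real n * (real n - 1)) * (real n * (real n - 2) / 6)
      \<le> (real n * (real n - 1)) * real (max_blocking n S)"
    by linarith
  then show ?thesis
    using n by (subst (asm) mult_le_cancel_left_pos) auto
qed auto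

theorem theorem3p2:
  fixes n :: nat
  assumes "n \<ge> 1"
  shows "int (shield_number n) \<ge> \<lceil>real n * (real n - 2) / 6\<rceil>"
proof -
  \<comment> \<open>The minimum is attained by some profile, and an integer above a real bound is
    above its ceiling.\<close>
  have "shield_number n \<in> {max_blocking n S | S. is_profile n S}"
    unfolding shield_number_def using finite_max_blocking nonempty_max_blocking by (rule Min_in)
  then show ?thesis
    using max_blocking_ge[OF assms] by (auto simp: ceiling_le_iff)
qed

end
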